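(* Let $v$ be the value function $$v(t,y)=\inf_{\omega\in\hat{\mathcal U}}\max\Bigl(v_0(X_y^\omega(T)),\ \sup_{\theta\in(t,T)}g(X_y^\omega(\theta))\Bigr),$$ and let $$\operatorname{Cap}_C(t)=\{y\in\Omega:\ \exists\,\omega\in\hat{\mathcal U}\text{ such that } X_y^\omega(T)\in C\text{ and }X_y^\omega(s)\in\hat K\text{ for all }s\in(t,T)\}.$$ Then for every $t\in[0,T]$, $$\operatorname{Cap}_C(t)=\{y\in\Omega:\ v(t,y)\le 0\}.$$
   Context: State space $\Omega=\mathbb{R}^2_+$, states $X=(P,I)$; horizon $T>0$. Constants: $a,b,c,\rho>0$; $\beta,\gamma,\theta\ge 0$ (in the dynamics, $\theta$ is a constant; in suprema $\theta$ is a time variable); $\alpha>\gamma$; the quality level $q\ge0$ is a fixed constant. The control set is $\mathbb{U}=[\underline p,\bar p]\times[0,\bar U]$ with $0\le\underline p\le\bar p$, $\bar U\ge0$, and $\hat{\mathcal U}$ is the set of measurable functions $\omega=(p,U):[0,+\infty)\to\mathbb{U}$. The demand $\rho U(a-bp+cq)$ takes values in $\mathbb{R}_+$. The dynamics is $$f(X,\omega)=\bigl(\alpha U\rho(a-bp+cq)-\beta I-\gamma P,\; P-\rho U(a-bp+cq)-\theta I\bigr),$$ and $X_y^\omega$ denotes the solution of $\dot X(s)=f(X(s),\omega(s))$ for $s\ge t$ with $X(t)=y$, where $t$ is the initial time under consideration. Constraint set and target: $\hat K=[P_{\min},P_{\max}]\times[I_{\min},I_{\max}]\subset\mathbb{R}^2_+$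 and $C=[\tilde P,P_{\max}]\times[\tilde I,I_{\max}]$ with $\tilde P\in[P_{\min},P_{\max}]$, $\tilde I\in[I_{\min},I_{\max}]$ (nonempty closed sets). For a set $M$, $\mathrm d_M(x)=\inf\{|x-z|:z\in M\}$. The functions $g$ and $v_0$ are $$g(x)=\begin{cases}\mathrm d_{\hat K}(x), & x\notin\hat K,\\ -\mathrm d_{\Omega\setminus\hat K}(x), & x\in\hat K,\end{cases}\qquad v_0(x)=\begin{cases}\mathrm d_{C}(x), & x\notin C,\\ -\mathrm d_{\Omega\setminus C}(x), & x\in C,\end{cases}$$ and they are taken to be Lipschitz continuous with $g(x)\le0\Leftrightarrow x\in\hat K$ and $v_0(x)\le 0\Leftrightarrow x\in C$. At $t=T$ the value is read as $v(T,y)=\max(v_0(y),g(y))$. *)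

theory Defs
  imports "HOL-Analysis.Analysis"
begin

definition Omega :: "(real \<times> real) set" where
  "Omega = {0..} \<times> {0..}"

definition demand :: "real \<Rightarrow> real \<Rightarrow> real \<Rightarrow> real \<Rightarrow> real \<Rightarrow> real \<times> real \<Rightarrow> real" where
  "demand \<rho> a b c q = (\<lambda>(p, U). \<rho> * U * (a - b * p + c * q))"

definition dynamics ::
  "real \<Rightarrow> real \<Rightarrow> real \<Rightarrow> real \<Rightarrow> (real \<times> real \<Rightarrow> real) \<Rightarrow> real \<times> real \<Rightarrow> real \<times> real \<Rightarrow> real \<times> real"
  where
  "dynamics \<alpha> \<beta> \<gamma> \<theta> D = (\<lambda>(P, I) w. (\<alpha> * D w - \<beta> * I - \<gamma> * P, P - D w - \<theta> * I))"

definition controls :: "(real \<times> real) set \<Rightarrow> (real \<Rightarrow> real \<times> real) set" where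
  "controls \<U> = {\<omega>. \<omega> \<in> borel_measurable (lebesgue_on {0..}) \<and> (\<forall>s\<ge>0. \<omega> s \<in> \<U>)}"

text \<open>
  Controls are merely measurable, so solutions are taken in the sense of Caratheodory: locally
  absolutely continuous curves satisfying the differential equation almost everywhere, i.e.
  solutions of the integral equation. Trajectories live in the whole plane and are not required
  to remain in \<^const>\<open>Omega\<close>.
\<close>

definition solves ::
  "(real \<times> real \<Rightarrow> real \<times> real \<Rightarrow> real \<times> real) \<Rightarrow> real \<Rightarrow> real \<times> real \<Rightarrow>
    (real \<Rightarrow> real \<times> real) \<Rightarrow> (real \<Rightarrow> real \<times> real) \<Rightarrow> bool" where
  "solves f t y \<omega> X \<longleftrightarrow>
    (\<forall>s\<ge>t. (\<lambda>r. f (X r) (\<omega> r)) absolutely_integrable_on {t..s} \<and>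
           X s = y + integral {t..s} (\<lambda>r. f (X r) (\<omega> r)))"

text \<open>
  For the dynamics above, the solution exists and is unique on \<open>{t..}\<close>; its values before the
  initial time \<open>t\<close> are arbitrary and never used.
\<close>

definition traj ::
  "(real \<times> real \<Rightarrow> real \<times> real \<Rightarrow> real \<times> real) \<Rightarrow> real \<Rightarrow> real \<times> real \<Rightarrow>
    (real \<Rightarrow> real \<times> real) \<Rightarrow> real \<Rightarrow> real \<times> real" where
  "traj f t y \<omega> = (SOME X. solves f t y \<omega> X)"

definition signed_dist :: "(real \<times> real) set \<Rightarrow> real \<times> real \<Rightarrow> real" where
  "signed_dist M x = (if x \<notin> M then infdist x M else - infdist x (Omega - M))"

text \<open>
  \<^const>\<open>signed_dist\<close> of a nonempty closed set is automatically Lipschitz on the state space and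
  has that set as its zero sublevel set, so neither property is a hypothesis anywhere.
\<close>

lemma signed_dist_le_0_iff:
  assumes "closed M" "M \<noteq> {}"
  shows "signed_dist M x \<le> 0 \<longleftrightarrow> x \<in> M"
  using infdist_pos_not_in_closed[OF assms, of x] infdist_nonneg[of x "Omega - M"]
  by (auto simp: signed_dist_def)

lemma signed_dist_lipschitz:
  assumes "closed M" "M \<noteq> {}"
  shows "1-lipschitz_on Omega (signed_dist M)"
proof -
  have cross: "\<bar>signed_dist M x - signed_dist M y\<bar> \<le> dist x y"
    if xy: "x \<in> Omega" "y \<in> Omega" "x \<in> M" "y \<notin> M" for x y
  proof -
    let ?S = "closed_segment x y"
    have sub: "?S \<subseteq> Omega"
      using xy(1,2) unfolding Omega_def
      by (rule closed_segment_subset) (intro convex_Times convex_real_interval)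
    have "connected ?S" by simp
    moreover have "?S \<subseteq> M \<union> closure (?S - M)"
      using closure_subset[of "?S - M"] by blast
    moreover have "y \<in> closure (?S - M)"
      by (rule subsetD[OF closure_subset]) (use xy in simp)
    moreover have "x \<in> M \<inter> ?S" "y \<in> closure (?S - M) \<inter> ?S"
      using xy \<open>y \<in> closure (?S - M)\<close> by auto
    ultimately have "M \<inter> closure (?S - M) \<inter> ?S \<noteq> {}"
      using connected_closedD[of ?S M "closure (?S - M)", OF _ _ _ assms(1) closed_closure]
      by blast
    then obtain z where z: "z \<in> M" "z \<in> closure (?S - M)" "z \<in> ?S" by blast
    have "z \<in> closure (Omega - M)"
      using z(2) closure_mono[OF Diff_mono[OF sub order_refl]] by (rule subsetD[rotated])
    then have "infdist z (Omega - M) = 0"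
      using xy(2,4) in_closure_iff_infdist_zero[of "Omega - M" z] by blast
    then have "infdist x (Omega - M) \<le> dist x z"
      using infdist_triangle[of x "Omega - M" z] by simp
    moreover have "infdist y M \<le> dist y z"
      using z(1) by (rule infdist_le)
    moreover have "dist x z + dist y z = dist x y"
      using z(3) between_mem_segment[of x y z] between[of x y z] by (simp add: dist_commute)
    ultimately show ?thesis
      using xy infdist_nonneg[of x "Omega - M"] infdist_nonneg[of y M]
      by (simp add: signed_dist_def)
  qed
  show ?thesis
  proof (rule lipschitz_onI)
    fix x y assume xy: "x \<in> Omega" "y \<in> Omega"
    have "\<bar>signed_dist M x - signed_dist M y\<bar> \<le> dist x y"
    proof (cases "x \<in> M"; cases "y \<in> M")
      assume "x \<in> M" "y \<in> M"
      then show ?thesis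
        using infdist_triangle_abs[of x "Omega - M" y] by (simp add: signed_dist_def)
    next
      assume "x \<in> M" "y \<notin> M"
      then show ?thesis using cross xy by blast
    next
      assume "x \<notin> M" "y \<in> M"
      then show ?thesis using cross[of y x] xy by (simp add: dist_commute abs_minus_commute)
    next
      assume "x \<notin> M" "y \<notin> M"
      then show ?thesis
        using infdist_triangle_abs[of x M y] by (simp add: signed_dist_def)
    qed
    then show "dist (signed_dist M x) (signed_dist M y) \<le> 1 * dist x y"
      by (simp add: dist_real_def)
  qed simp
qed

text \<open>
  The supremum over \<open>{t<..<T}\<close> is empty at \<open>t = T\<close>, where the constraint is instead evaluated at
  \<open>y\<close>. For \<open>t < T\<close> the supremum and the infimum are of nonempty bounded sets of reals.
\<close>

definition value_function ::
  "(real \<times> real \<Rightarrow> real \<times> real \<Rightarrow> real \<times> real) \<Rightarrow> (real \<times> real) set \<Rightarrow>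
    (real \<times> real \<Rightarrow> real) \<Rightarrow> (real \<times> real \<Rightarrow> real) \<Rightarrow> real \<Rightarrow> real \<Rightarrow> real \<times> real \<Rightarrow> real" where
  "value_function f \<U> v\<^sub>0 g T t y =
    (if t = T then max (v\<^sub>0 y) (g y)
     else INF \<omega>\<in>controls \<U>.
            max (v\<^sub>0 (traj f t y \<omega> T)) (SUP s\<in>{t<..<T}. g (traj f t y \<omega> s)))"

definition Cap ::
  "(real \<times> real \<Rightarrow> real \<times> real \<Rightarrow> real \<times> real) \<Rightarrow> (real \<times> real) set \<Rightarrow>
    (real \<times> real) set \<Rightarrow> (real \<times> real) set \<Rightarrow> real \<Rightarrow> real \<Rightarrow> (real \<times> real) set" where
  "Cap f \<U> K C T t =
    {y \<in> Omega. \<exists>\<omega>\<in>controls \<U>. traj f t y \<omega> T \<in> C \<and> (\<forall>s\<in>{t<..<T}. traj f t y \<omega> s \<in> K)}"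

end

theory Submission
  imports Defs "HOL-Complex_Analysis.Great_Picard"
begin

text \<open>
  A viable control makes every signed distance entering the cost nonpositive, so the capture basin
  lies in the sublevel set. The other inclusion says that a nonpositive infimum is witnessed by
  a control of nonpositive cost, which is a compactness property of the set of trajectories.

  Compactness comes from the special form of the dynamics, \<open>A x + D w *\<^sub>R B\<close> with \<open>A\<close> linear and a
  scalar demand \<open>D w\<close> that fills an interval \<open>{0..m}\<close>. The trajectory solves the Volterra equation
  \<open>X s = y + V s *\<^sub>R B + integral {t..s} (\<lambda>r. A (X r))\<close>, where \<open>V\<close> is the cumulative demand. So it
  depends on the control only through \<open>V\<close>, continuously for uniform convergence
  (\<open>volterra_stability\<close>). Cumulative demands are monotone and \<open>m\<close>-Lipschitz, hence uniformly
  relatively compact by Arzela--Ascoli. Monotonicity and the Lipschitz bound pass to the limit, and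
  any function with these two properties is the integral of a density with values in \<open>{0..m}\<close>
  (\<open>bounded_slope_obtain_density\<close>, through Radon--Nikodym). Lifting this density to the control set
  by a measurable section of \<open>D\<close> gives a control whose trajectory is the limit of the given ones
  (\<open>traj_compact\<close>).

  Along a minimizing sequence the distance to the target at the final time and the distance to the
  constraint set at each earlier time tend to \<open>0\<close>. Both sets are closed, so the limit trajectory
  reaches the target and stays in the constraint set.
\<close>

section \<open>Linear Volterra equations\<close>

text \<open>
  The function \<open>exp (- L * (s - t)) * (\<epsilon> + L * integral {t..s} \<phi>)\<close> has a nonpositive derivative,
  precisely by the hypothesis, so it never exceeds its initial value \<open>\<epsilon>\<close>.
\<close>

lemma gronwall:
  fixes \<phi> :: "real \<Rightarrow> real"
  assumes cont: "continuous_on {t..b} \<phi>" and L: "0 \<le> L"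
    and le: "\<And>s. s \<in> {t..b} \<Longrightarrow> \<phi> s \<le> \<epsilon> + L * integral {t..s} \<phi>"
    and s: "s \<in> {t..b}"
  shows "\<phi> s \<le> \<epsilon> * exp (L * (s - t))"
proof -
  define w where "w = (\<lambda>s. exp (- L * (s - t)) * (\<epsilon> + L * integral {t..s} \<phi>))"
  define w' where "w' = (\<lambda>s. exp (- L * (s - t)) * (L * (\<phi> s - (\<epsilon> + L * integral {t..s} \<phi>))))"
  have der: "(w has_field_derivative w' r) (at r within {t..b})" if "r \<in> {t..b}" for r
  proof -
    have [derivative_intros]:
      "((\<lambda>u. integral {t..u} \<phi>) has_field_derivative \<phi> r) (at r within {t..b})"
      using integral_has_vector_derivative[OF cont that]
      by (simp add: has_real_derivative_iff_has_vector_derivative)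
    show ?thesis
      unfolding w_def w'_def by (auto intro!: derivative_eq_intros simp: algebra_simps)
  qed
  have "w s \<le> w t"
  proof (rule DERIV_nonpos_imp_decreasing_open[where f = w and a = t and b = s])
    show "t \<le> s" using s by simp
    show "continuous_on {t..s} w"
      by (rule continuous_on_subset[OF DERIV_continuous_on[OF der]]) (use s in auto)
    fix r assume r: "t < r" "r < s"
    then have "at r within {t..b} = at r"
      using s by (simp add: at_within_Icc_at)
    with der[of r] have "DERIV w r :> w' r" using r s by simp
    moreover have "w' r \<le> 0"
      unfolding w'_def using le[of r] r s L
      by (intro mult_nonneg_nonpos) auto
    ultimately show "\<exists>y. DERIV w r :> y \<and> y \<le> 0" by blast
  qed
  then have "exp (L * (s - t)) * w s \<le> exp (L * (s - t)) * w t"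
    by (rule mult_left_mono) simp
  moreover have "exp (L * (s - t)) * w s = \<epsilon> + L * integral {t..s} \<phi>"
    by (simp add: w_def exp_minus_inverse flip: mult.assoc)
  moreover have "w t = \<epsilon>" by (simp add: w_def)
  ultimately have "\<epsilon> + L * integral {t..s} \<phi> \<le> \<epsilon> * exp (L * (s - t))"
    by (metis mult.commute)
  then show ?thesis using le[OF s] by linarith
qed

text \<open>
  The difference of two solutions satisfies Gronwall's hypothesis, with the distance of the forcing
  terms as the constant. With \<open>\<epsilon> = 0\<close> this is uniqueness; for small \<open>\<epsilon>\<close> it says that
  uniform convergence of the forcing terms forces convergence of the solutions.
\<close>

lemma volterra_stability:
  fixes A :: "'a::banach \<Rightarrow> 'a"
  assumes A: "bounded_linear A" and L: "\<And>x. norm (A x) \<le> norm x * L" "0 \<le> L"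
    and X: "continuous_on {t..b} X" "\<And>s. s \<in> {t..b} \<Longrightarrow> X s = g s + integral {t..s} (\<lambda>r. A (X r))"
    and Y: "continuous_on {t..b} Y" "\<And>s. s \<in> {t..b} \<Longrightarrow> Y s = h s + integral {t..s} (\<lambda>r. A (Y r))"
    and \<epsilon>: "\<And>s. s \<in> {t..b} \<Longrightarrow> norm (g s - h s) \<le> \<epsilon>"
    and s: "s \<in> {t..b}"
  shows "norm (X s - Y s) \<le> \<epsilon> * exp (L * (s - t))"
proof (rule gronwall[where \<phi> = "\<lambda>s. norm (X s - Y s)", OF _ L(2) _ s])
  show contXY: "continuous_on {t..b} (\<lambda>s. norm (X s - Y s))"
    by (intro continuous_intros X Y)
  fix s assume s: "s \<in> {t..b}"
  have sub: "{t..s} \<subseteq> {t..b}" using s by auto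
  have int: "(\<lambda>r. A (X r)) integrable_on {t..s}" "(\<lambda>r. A (Y r)) integrable_on {t..s}"
    by (intro integrable_continuous_real continuous_on_subset[OF _ sub]
        bounded_linear.continuous_on[OF A] X Y)+
  have eq: "X s - Y s = (g s - h s) + integral {t..s} (\<lambda>r. A (X r - Y r))"
    using X(2)[OF s] Y(2)[OF s] integral_diff[OF int]
    by (simp add: linear_diff[OF bounded_linear.linear[OF A]])
  have "norm (integral {t..s} (\<lambda>r. A (X r - Y r))) \<le> integral {t..s} (\<lambda>r. L * norm (X r - Y r))"
  proof (rule integral_norm_bound_integral)
    show "(\<lambda>r. A (X r - Y r)) integrable_on {t..s}"
      by (intro integrable_continuous_real continuous_on_subset[OF _ sub]
        bounded_linear.continuous_on[OF A] continuous_intros X Y)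
    show "(\<lambda>r. L * norm (X r - Y r)) integrable_on {t..s}"
      by (intro integrable_continuous_real continuous_intros continuous_on_subset[OF contXY sub])
  qed (use L in \<open>simp add: mult.commute\<close>)
  then show "norm (X s - Y s) \<le> \<epsilon> + L * integral {t..s} (\<lambda>r. norm (X r - Y r))"
    unfolding eq using \<epsilon>[OF s] by (intro norm_triangle_le) simp
qed

text \<open>
  The solution is the Neumann series: iterating \<open>\<phi> \<mapsto> (\<lambda>s. integral {t..s} (\<lambda>r. A (\<phi> r)))\<close> on \<open>g\<close>
  gives terms bounded by \<open>M * (L * (s - t)) ^ n / fact n\<close>. The factorial makes the series converge
  uniformly on every compact interval, so one solution serves the whole half-line.
\<close>

lemma volterra_ex:
  fixes A :: "'a::banach \<Rightarrow> 'a" and g :: "real \<Rightarrow> 'a"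
  assumes A: "bounded_linear A" and g: "\<And>b. continuous_on {t..b} g"
  obtains X where "\<And>b. continuous_on {t..b} X"
    "\<And>s. t \<le> s \<Longrightarrow> X s = g s + integral {t..s} (\<lambda>r. A (X r))"
proof -
  note contA = bounded_linear.continuous_on[OF A]
  obtain L where L: "0 \<le> L" "\<And>x. norm (A x) \<le> norm x * L"
    using bounded_linear.nonneg_bounded[OF A] by blast
  define \<phi> where "\<phi> = rec_nat g (\<lambda>_ h s. integral {t..s} (\<lambda>r. A (h r)))"
  have \<phi>0: "\<phi> 0 = g" and \<phi>Suc: "\<phi> (Suc n) = (\<lambda>s. integral {t..s} (\<lambda>r. A (\<phi> n r)))" for n
    by (simp_all add: \<phi>_def)
  have cont: "continuous_on {t..b} (\<phi> n)" for n b
  proof (induction n)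
    case 0 then show ?case using g by (simp add: \<phi>0)
  next
    case (Suc n)
    show ?case unfolding \<phi>Suc
      by (intro indefinite_integral_continuous_1 integrable_continuous_real contA Suc.IH)
  qed
  have int: "(\<lambda>r. A (\<phi> n r)) integrable_on {t..s}" for n s
    by (intro integrable_continuous_real contA cont)
  define S where "S = (\<lambda>N s. \<Sum>n<N. \<phi> n s)"
  have contS: "continuous_on {t..b} (S N)" for N b
    unfolding S_def by (intro continuous_intros cont)
  define X where "X = (\<lambda>s. \<Sum>n. \<phi> n s)"
  have lim: "uniform_limit {t..b} S X sequentially" for b
  proof -
    have "bounded (g ` {t..b})"
      by (intro compact_imp_bounded compact_continuous_image g) simp
    then obtain M where M: "\<And>s. s \<in> {t..b} \<Longrightarrow> norm (g s) \<le> M" "0 < M"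
      unfolding bounded_pos by blast
    \<comment> \<open>The factorial enters because each iteration integrates the power of \<open>r - t\<close> once more.\<close>
    have bound: "norm (\<phi> n s) \<le> M * ((L * (s - t)) ^ n / fact n)" if "s \<in> {t..b}" for n s
      using that
    proof (induction n arbitrary: s)
      case 0 then show ?case using M by (simp add: \<phi>0)
    next
      case (Suc n)
      have prim: "((\<lambda>r. M * L ^ Suc n / fact n * (r - t) ^ n) has_integral
          (M * ((L * (s - t)) ^ Suc n / fact (Suc n)) - M * ((L * (t - t)) ^ Suc n / fact (Suc n)))) {t..s}"
      proof (rule fundamental_theorem_of_calculus)
        show "t \<le> s" using Suc.prems by simp
        fix r
        have "((\<lambda>s. M * ((L * (s - t)) ^ Suc n / fact (Suc n))) has_field_derivative
            M * L ^ Suc n / fact n * (r - t) ^ n) (at r within {t..s})"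
          apply (rule derivative_eq_intros refl | simp)+
          by (simp add: field_simps flip: power_mult_distrib)
        then show "((\<lambda>s. M * ((L * (s - t)) ^ Suc n / fact (Suc n))) has_vector_derivative
            M * L ^ Suc n / fact n * (r - t) ^ n) (at r within {t..s})"
          by (simp add: has_real_derivative_iff_has_vector_derivative)
      qed
      have "norm (\<phi> (Suc n) s) \<le> integral {t..s} (\<lambda>r. M * L ^ Suc n / fact n * (r - t) ^ n)"
        unfolding \<phi>Suc
      proof (rule integral_norm_bound_integral[OF int has_integral_integrable[OF prim]])
        fix r assume "r \<in> {t..s}"
        then have "norm (\<phi> n r) \<le> M * ((L * (r - t)) ^ n / fact n)" using Suc by auto
        then have "norm (\<phi> n r) * L \<le> M * ((L * (r - t)) ^ n / fact n) * L"
          using L(1) by (rule mult_right_mono)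
        with L(2)[of "\<phi> n r"] show "norm (A (\<phi> n r)) \<le> M * L ^ Suc n / fact n * (r - t) ^ n"
          by (simp add: power_mult_distrib mult_ac)
      qed
      also have "\<dots> = M * ((L * (s - t)) ^ Suc n / fact (Suc n))"
        using integral_unique[OF prim] by simp
      finally show ?case .
    qed
    have "uniform_limit {t..b} (\<lambda>N s. \<Sum>n<N. \<phi> n s) X sequentially"
      unfolding X_def
    proof (rule Weierstrass_m_test)
      show "norm (\<phi> n s) \<le> M * ((L * (b - t)) ^ n / fact n)" if "s \<in> {t..b}" for n s
        by (rule order_trans[OF bound[OF that]])
          (use that L M in \<open>intro mult_left_mono divide_right_mono power_mono, auto\<close>)
      show "summable (\<lambda>n. M * ((L * (b - t)) ^ n / fact n))"
        using summable_exp[of "L * (b - t)"] by (intro summable_mult) (simp add: divide_inverse mult.commute)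
    qed
    then show ?thesis unfolding S_def .
  qed
  have contX: "continuous_on {t..b} X" for b
    by (rule uniform_limit_theorem[OF _ lim]) (auto intro!: always_eventually contS)
  show thesis
  proof (rule that[OF contX])
    fix s assume s: "t \<le> s"
    have ul: "uniform_limit {t..s} (\<lambda>N r. A (S N r)) (\<lambda>r. A (X r)) sequentially"
      by (rule bounded_linear.uniform_limit[OF A lim])
    obtain I J where IJ: "\<And>N. ((\<lambda>r. A (S N r)) has_integral I N) {t..s}"
        "((\<lambda>r. A (X r)) has_integral J) {t..s}" "I \<longlonglongrightarrow> J"
      using uniform_limit_integral[OF ul contA[OF contS]] by auto
    have "S (Suc N) s = g s + I N" for N
    proof -
      have "I N = integral {t..s} (\<lambda>r. A (S N r))" by (rule integral_unique[OF IJ(1), symmetric])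
      also have "\<dots> = (\<Sum>n<N. \<phi> (Suc n) s)"
        unfolding S_def \<phi>Suc linear_sum[OF bounded_linear.linear[OF A]]
        by (rule integral_sum) (auto intro: int)
      finally show ?thesis
        unfolding S_def by (simp add: sum.lessThan_Suc_shift \<phi>0 del: sum.lessThan_Suc)
    qed
    then have "(\<lambda>N. S (Suc N) s) \<longlonglongrightarrow> g s + J"
      using tendsto_add[OF tendsto_const IJ(3)] by simp
    moreover have "(\<lambda>N. S (Suc N) s) \<longlonglongrightarrow> X s"
      using tendsto_uniform_limitI[OF lim[of s], of s] s by (auto intro: LIMSEQ_Suc)
    ultimately show "X s = g s + integral {t..s} (\<lambda>r. A (X r))"
      using LIMSEQ_unique IJ(2) integral_unique by blast
  qed
qed

section \<open>Monotone Lipschitz functions as integrals\<close>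

text \<open>
  A monotone Lipschitz function is the integral of a bounded density. After rescaling to slope at
  most \<open>1\<close>, both \<open>W1\<close> and \<open>W2 = (\<lambda>x. x - W1 x)\<close> are continuous and monotone, and their
  Lebesgue--Stieltjes measures add up to Lebesgue measure. Hence both are absolutely continuous, and
  their Radon--Nikodym derivatives add up to \<open>1\<close> almost everywhere, which bounds each of them by \<open>1\<close>.
\<close>

lemma bounded_slope_obtain_density:
  fixes V :: "real \<Rightarrow> real"
  assumes slope: "\<And>x y. x \<le> y \<Longrightarrow> 0 \<le> V y - V x \<and> V y - V x \<le> L * (y - x)"
  obtains u where "u \<in> borel_measurable borel" "\<And>x. 0 \<le> u x \<and> u x \<le> L"
    "\<And>x y. x \<le> y \<Longrightarrow> (u has_integral (V y - V x)) {x..y}"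
proof (cases "L > 0")
  case False
  with slope[of 0 1] have "L = 0" by simp
  with slope have "V y - V x = 0" if "x \<le> y" for x y using that by fastforce
  with \<open>L = 0\<close> show thesis by (intro that[of "\<lambda>_. 0"]) auto
next
  case True
  define W1 where "W1 = (\<lambda>x. V x / L)"
  define W2 where "W2 = (\<lambda>x. x - W1 x)"
  have W1_slope: "0 \<le> W1 y - W1 x \<and> W1 y - W1 x \<le> y - x" if "x \<le> y" for x y
  proof -
    have "W1 y - W1 x = (V y - V x) / L" by (simp add: W1_def diff_divide_distrib)
    then show ?thesis using slope[OF that] True by (simp add: pos_divide_le_eq mult.commute)
  qed
  have mono: "W1 x \<le> W1 y" "W2 x \<le> W2 y" if "x \<le> y" for x y
    using W1_slope[OF that] by (auto simp: W2_def)
  have contW1: "continuous_on UNIV W1"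
    by (intro lipschitz_on_continuous_on[where L = 1] lipschitz_onI)
      (smt (verit) W1_slope dist_real_def, simp)
  have cont: "continuous_on UNIV W1" "continuous_on UNIV W2"
    using contW1 by (auto simp: W2_def intro!: continuous_intros)
  have Ioc: "emeasure (interval_measure F) {x<..y} = ennreal (F y - F x)"
    and Icc: "emeasure (interval_measure F) {x..y} = ennreal (F y - F x)"
    if "F = W1 \<or> F = W2" "x \<le> y" for F x y
  proof -
    have m: "\<And>x y. x \<le> y \<Longrightarrow> F x \<le> F y" and c: "continuous_on UNIV F"
      using that(1) mono cont by auto
    have rc: "\<And>a. continuous (at_right a) F"
      using c by (auto intro: continuous_within_subset simp: continuous_on_eq_continuous_within)
    show "emeasure (interval_measure F) {x<..y} = ennreal (F y - F x)"
      by (rule emeasure_interval_measure_Ioc[OF that(2) m rc])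
    show "emeasure (interval_measure F) {x..y} = ennreal (F y - F x)"
      by (rule emeasure_interval_measure_Icc[OF that(2) m c])
  qed
  define \<mu> where "\<mu> = interval_measure W1"
  define \<nu> where "\<nu> = interval_measure W2"
  have [measurable_cong, simp]: "sets \<mu> = sets borel" "sets \<nu> = sets borel" by (simp_all add: \<mu>_def \<nu>_def)
  \<comment> \<open>Neither measure charges points, so on open intervals the sum is the length; this
    identifies it as Lebesgue measure.\<close>
  define N where "N = measure_of UNIV (sets borel) (\<lambda>A. emeasure \<mu> A + emeasure \<nu> A)"
  have N: "emeasure N A = emeasure \<mu> A + emeasure \<nu> A" if "A \<in> sets borel" for A
    unfolding N_def
  proof (rule emeasure_measure_of_sigma)
    show "sigma_algebra UNIV (sets (borel :: real measure))"
      using sets.sigma_algebra_axioms[of "borel :: real measure"] by simp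
    show "positive (sets borel) (\<lambda>A. emeasure \<mu> A + emeasure \<nu> A)"
      by (simp add: positive_def)
    show "countably_additive (sets borel) (\<lambda>A. emeasure \<mu> A + emeasure \<nu> A)"
      by (rule countably_additiveI)
        (auto simp: suminf_add[symmetric] suminf_emeasure)
  qed (use that in simp)
  have sum_lborel: "lborel = N"
  proof (rule lborel_eqI)
    show "sets N = sets borel"
      unfolding N_def using sets.sigma_sets_eq[of "borel :: real measure"] by simp
    fix l u :: real assume "\<And>b. b \<in> Basis \<Longrightarrow> l \<bullet> b \<le> u \<bullet> b"
    then have lu: "l \<le> u" by simp
    have null: "emeasure M {u} = 0" if "M = \<mu> \<or> M = \<nu>" for M
      using that Icc[of W1 u u] Icc[of W2 u u] by (auto simp: \<mu>_def \<nu>_def)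
    have Ioo: "emeasure M {l<..<u} = emeasure M {l<..u}" if M: "M = \<mu> \<or> M = \<nu>" for M
    proof (cases "l < u")
      case True
      have [simp]: "sets M = sets borel" using M by auto
      have "{l<..u} = {l<..<u} \<union> {u}" using True by auto
      then show ?thesis
        using emeasure_Un_null_set[of "{l<..<u}" M "{u}"] null[OF M] by (simp add: null_sets_def)
    qed (use lu in auto)
    have "emeasure N (box l u) = ennreal (W1 u - W1 l) + ennreal (W2 u - W2 l)"
      using N[of "{l<..<u}"] Ioo[of \<mu>] Ioo[of \<nu>] Ioc[OF _ lu, of W1] Ioc[OF _ lu, of W2]
      by (simp add: \<mu>_def \<nu>_def box_real)
    also have "\<dots> = ennreal (u - l)"
      using mono[OF lu] by (simp add: ennreal_plus[symmetric] W2_def del: ennreal_plus)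
    finally show "emeasure N (box l u) = (\<Prod>b\<in>Basis. (u - l) \<bullet> b)" by simp
  qed
  have sum_eq: "emeasure lborel A = emeasure \<mu> A + emeasure \<nu> A" if "A \<in> sets borel" for A
    using N[OF that] by (simp add: sum_lborel)
  have ac: "absolutely_continuous lborel \<mu>" "absolutely_continuous lborel \<nu>"
    using sum_eq by (auto simp: absolutely_continuous_def null_sets_def)
  obtain h where h: "h \<in> borel_measurable lborel" "density lborel h = \<mu>"
    using sigma_finite_measure.Radon_Nikodym[OF sigma_finite_lborel ac(1)] by auto
  obtain k where k: "k \<in> borel_measurable lborel" "density lborel k = \<nu>"
    using sigma_finite_measure.Radon_Nikodym[OF sigma_finite_lborel ac(2)] by auto
  have [measurable]: "h \<in> borel_measurable borel" "k \<in> borel_measurable borel" using h k by auto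
  have "density lborel (\<lambda>x. h x + k x) = density lborel (\<lambda>_. 1)"
  proof (rule measure_eqI)
    fix A :: "real set" assume "A \<in> sets (density lborel (\<lambda>x. h x + k x))"
    then have A [measurable]: "A \<in> sets borel" by simp
    have "emeasure (density lborel (\<lambda>x. h x + k x)) A
      = (\<integral>\<^sup>+x. h x * indicator A x \<partial>lborel) + (\<integral>\<^sup>+x. k x * indicator A x \<partial>lborel)"
      by (simp add: emeasure_density distrib_right nn_integral_add)
    also have "\<dots> = emeasure \<mu> A + emeasure \<nu> A"
      by (simp flip: h(2) k(2) add: emeasure_density)
    finally show "emeasure (density lborel (\<lambda>x. h x + k x)) A = emeasure (density lborel (\<lambda>_. 1)) A"
      by (simp add: sum_eq emeasure_density)
  qed simp
  then have "AE x in lborel. h x + k x = 1"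
    by (intro sigma_finite_measure.density_unique[OF sigma_finite_lborel]) auto
  then have h_le: "AE x in lborel. h x \<le> 1"
    by eventually_elim (metis le_iff_add)
  \<comment> \<open>Truncation makes the bound hold everywhere and the density finite, changing it only on a null set.\<close>
  define v where "v = (\<lambda>x. enn2real (min (h x) 1))"
  have [measurable]: "v \<in> borel_measurable borel" unfolding v_def by measurable
  have v01: "0 \<le> v x \<and> v x \<le> 1" for x
    unfolding v_def using enn2real_mono[of "min (h x) 1" 1] by simp
  have v_h: "AE x in lborel. ennreal (v x) = h x"
    using h_le by eventually_elim (auto simp: v_def min_def ennreal_enn2real_if top_unique)
  have v_int: "(v has_integral (W1 y - W1 x)) {x..y}" if "x \<le> y" for x y
  proof -
    have "(\<integral>\<^sup>+r. ennreal (v r * indicator {x..y} r) \<partial>lborel) = (\<integral>\<^sup>+r. h r * indicator {x..y} r \<partial>lborel)"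
      using v_h by (intro nn_integral_cong_AE) (auto simp: indicator_def)
    also have "\<dots> = ennreal (W1 y - W1 x)"
      using Icc[OF _ that, of W1] by (simp flip: h(2) add: emeasure_density \<mu>_def[symmetric])
    finally have "((\<lambda>r. v r * indicator {x..y} r) has_integral (W1 y - W1 x)) UNIV"
      using v01 mono[OF that] by (intro nn_integral_has_integral) auto
    moreover have "(\<lambda>r. v r * indicator {x..y} r) = (\<lambda>r. if r \<in> {x..y} then v r else 0)"
      by (auto simp: indicator_def)
    ultimately show ?thesis
      using has_integral_restrict_UNIV[of "{x..y}" v] by metis
  qed
  show thesis
  proof (rule that[of "\<lambda>x. L * v x"])
    show "0 \<le> L * v x \<and> L * v x \<le> L" for x
      using v01[of x] True by (auto simp: mult_left_le)
    show "((\<lambda>x. L * v x) has_integral (V y - V x)) {x..y}" if "x \<le> y" for x y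
    proof -
      have "L * (W1 y - W1 x) = V y - V x"
        using True by (simp add: W1_def right_diff_distrib)
      then show ?thesis using has_integral_mult_right[OF v_int[OF that], of L] by simp
    qed
  qed measurable
qed

section \<open>Signed distances\<close>

lemma signed_dist_le_infdist: "signed_dist M x \<le> infdist x M"
  by (simp add: signed_dist_def infdist_nonneg)

text \<open>
  Near-optimal trajectories only have small positive signed distances. The ordinary distance to the
  set is then small too, and it is continuous on the whole plane, which suits passing to the limit.
\<close>

lemma infdist_less_of_signed_dist_less:
  assumes "signed_dist M x < e" "0 < e"
  shows "infdist x M < e"
  using assms by (cases "x \<in> M") (simp_all add: signed_dist_def)

lemma signed_dist_bounded_below:
  assumes "compact M"
  obtains l where "\<And>x. l \<le> signed_dist M x"
proof -
  have "compact ((\<lambda>x. infdist x (Omega - M)) ` M)"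
    by (intro compact_continuous_image assms continuous_intros)
  then obtain h where h: "\<And>x. x \<in> M \<Longrightarrow> infdist x (Omega - M) \<le> h"
    using compact_imp_bounded bounded_has_Sup(1) by (metis bounded_imp_bdd_above bdd_above.E image_eqI)
  have "min 0 (- h) \<le> signed_dist M x" for x
    using h[of x] infdist_nonneg[of x M] by (cases "x \<in> M") (auto simp: signed_dist_def)
  then show thesis by (rule that)
qed

section \<open>Control systems driven by a bounded scalar input\<close>

text \<open>
  The control acts only through a scalar \<open>D w\<close> that ranges over an interval \<open>{0..m}\<close>. The map \<open>\<sigma>\<close>
  is a measurable section of \<open>D\<close> and turns a measurable scalar input back into a control.
\<close>

locale affine_control_system =
  fixes A :: "real \<times> real \<Rightarrow> real \<times> real" and B :: "real \<times> real"
    and D :: "real \<times> real \<Rightarrow> real" and m :: real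
    and \<U> :: "(real \<times> real) set" and \<sigma> :: "real \<Rightarrow> real \<times> real"
  assumes A: "bounded_linear A"
    and D_measurable [measurable]: "D \<in> borel_measurable borel"
    and D_range: "w \<in> \<U> \<Longrightarrow> 0 \<le> D w \<and> D w \<le> m"
    and \<sigma>_measurable [measurable]: "\<sigma> \<in> borel_measurable borel"
    and \<sigma>: "0 \<le> u \<Longrightarrow> u \<le> m \<Longrightarrow> \<sigma> u \<in> \<U> \<and> D (\<sigma> u) = u"
    and m_nonneg: "0 \<le> m"
begin

definition rhs :: "real \<times> real \<Rightarrow> real \<times> real \<Rightarrow> real \<times> real" where
  "rhs x w = A x + D w *\<^sub>R B"

definition input :: "(real \<Rightarrow> real \<times> real) \<Rightarrow> real \<Rightarrow> real \<Rightarrow> real" where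
  "input \<omega> t s = integral {t..s} (\<lambda>r. D (\<omega> r))"

lemma controls_nonempty: "controls \<U> \<noteq> {}"
proof -
  have "(\<lambda>_. \<sigma> 0) \<in> controls \<U>"
    using \<sigma>[of 0] m_nonneg by (simp add: controls_def)
  then show ?thesis by blast
qed

lemma demand_absolutely_integrable:
  assumes "\<omega> \<in> controls \<U>" "0 \<le> t"
  shows "(\<lambda>r. D (\<omega> r)) absolutely_integrable_on {t..s}"
proof (rule measurable_bounded_by_integrable_imp_absolutely_integrable)
  have "\<omega> \<in> borel_measurable (lebesgue_on {0..})"
    using assms by (simp add: controls_def)
  then have "\<omega> \<in> borel_measurable (lebesgue_on {t..s})"
    by (rule measurable_restrict_mono) (use assms in auto)
  then show "(\<lambda>r. D (\<omega> r)) \<in> borel_measurable (lebesgue_on {t..s})"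
    by (rule measurable_compose) (rule D_measurable)
  show "norm (D (\<omega> r)) \<le> m" if "r \<in> {t..s}" for r
    using that assms D_range[of "\<omega> r"] by (simp add: controls_def)
qed auto

lemma input_slope:
  assumes "\<omega> \<in> controls \<U>" "0 \<le> t" "t \<le> x" "x \<le> y"
  shows "0 \<le> input \<omega> t y - input \<omega> t x \<and> input \<omega> t y - input \<omega> t x \<le> m * (y - x)"
proof -
  have int: "(\<lambda>r. D (\<omega> r)) integrable_on {z..y}" if "0 \<le> z" for z
    using demand_absolutely_integrable[OF assms(1) that] by (simp add: absolutely_integrable_on_def)
  have "input \<omega> t y - input \<omega> t x = integral {x..y} (\<lambda>r. D (\<omega> r))"
    unfolding input_def
    using Henstock_Kurzweil_Integration.integral_combine[OF assms(3,4) int[OF assms(2)]] by simp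
  moreover have "0 \<le> integral {x..y} (\<lambda>r. D (\<omega> r))"
    using assms D_range by (intro integral_nonneg int) (auto simp: controls_def)
  moreover have "integral {x..y} (\<lambda>r. D (\<omega> r)) \<le> integral {x..y} (\<lambda>_. m)"
    using assms D_range by (intro integral_le int) (auto simp: controls_def)
  ultimately show ?thesis using assms by (simp add: mult.commute)
qed

lemma input_continuous:
  assumes "\<omega> \<in> controls \<U>" "0 \<le> t"
  shows "continuous_on {t..b} (input \<omega> t)"
  unfolding input_def using demand_absolutely_integrable[OF assms]
  by (intro indefinite_integral_continuous_1) (simp add: absolutely_integrable_on_def)

text \<open>
  Splitting off the input turns the Caratheodory equation into a linear Volterra equation whose
  forcing term is continuous even though the control is merely measurable. The trajectory therefore
  depends on the control through its cumulative input alone.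
\<close>

lemma solves_rhs_iff:
  assumes \<omega>: "\<omega> \<in> controls \<U>" and t: "0 \<le> t"
  shows "solves rhs t y \<omega> X \<longleftrightarrow> (\<forall>b. continuous_on {t..b} X) \<and>
    (\<forall>s\<ge>t. X s = (y + input \<omega> t s *\<^sub>R B) + integral {t..s} (\<lambda>r. A (X r)))"
proof -
  note Dint = demand_absolutely_integrable[OF \<omega> t]
  have DB: "(\<lambda>r. D (\<omega> r) *\<^sub>R B) absolutely_integrable_on {t..s}" for s
    using Dint by (rule absolutely_integrable_scaleR_right)
  have AX: "(\<lambda>r. A (X r)) absolutely_integrable_on {t..s}" if "continuous_on {t..s} X" for s
    using bounded_linear.continuous_on[OF A that] by (rule absolutely_integrable_continuous_real)
  have split: "integral {t..s} (\<lambda>r. rhs (X r) (\<omega> r))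
      = input \<omega> t s *\<^sub>R B + integral {t..s} (\<lambda>r. A (X r))" if "continuous_on {t..s} X" for s
  proof -
    have "integral {t..s} (\<lambda>r. D (\<omega> r) *\<^sub>R B) = input \<omega> t s *\<^sub>R B"
      unfolding input_def using Dint[of s]
      by (intro integral_unique has_integral_scaleR_left integrable_integral)
        (simp add: absolutely_integrable_on_def)
    then show ?thesis
      unfolding rhs_def using AX[OF that] DB[of s]
      by (subst integral_add) (simp_all add: absolutely_integrable_on_def)
  qed
  show ?thesis
  proof (intro iffI conjI allI impI)
    assume sol: "solves rhs t y \<omega> X"
    show cont: "continuous_on {t..b} X" for b
    proof (cases "t \<le> b")
      case True
      then have "(\<lambda>r. rhs (X r) (\<omega> r)) integrable_on {t..b}"
        using sol by (simp add: solves_def absolutely_integrable_on_def)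
      then have "continuous_on {t..b} (\<lambda>s. y + integral {t..s} (\<lambda>r. rhs (X r) (\<omega> r)))"
        by (intro continuous_intros indefinite_integral_continuous_1)
      then show ?thesis
        by (rule continuous_on_eq) (use sol in \<open>simp add: solves_def\<close>)
    qed simp
    show "X s = (y + input \<omega> t s *\<^sub>R B) + integral {t..s} (\<lambda>r. A (X r))" if "t \<le> s" for s
      using sol that split[OF cont] by (simp add: solves_def add.assoc)
  next
    assume H: "(\<forall>b. continuous_on {t..b} X) \<and>
      (\<forall>s\<ge>t. X s = (y + input \<omega> t s *\<^sub>R B) + integral {t..s} (\<lambda>r. A (X r)))"
    have "(\<lambda>r. rhs (X r) (\<omega> r)) absolutely_integrable_on {t..s}" for s
      unfolding rhs_def using H AX DB by (intro set_integral_add) auto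
    with H show "solves rhs t y \<omega> X"
      by (simp add: solves_def split add.assoc)
  qed
qed

lemma traj_props:
  assumes \<omega>: "\<omega> \<in> controls \<U>" and t: "0 \<le> t"
  shows traj_continuous: "continuous_on {t..b} (traj rhs t y \<omega>)"
    and traj_eq: "t \<le> s \<Longrightarrow> traj rhs t y \<omega> s
      = (y + input \<omega> t s *\<^sub>R B) + integral {t..s} (\<lambda>r. A (traj rhs t y \<omega> r))"
proof -
  have "continuous_on {t..b} (\<lambda>s. y + input \<omega> t s *\<^sub>R B)" for b
    by (intro continuous_intros input_continuous assms)
  from volterra_ex[OF A this] obtain X where "solves rhs t y \<omega> X"
    unfolding solves_rhs_iff[OF assms] by metis
  then have "solves rhs t y \<omega> (traj rhs t y \<omega>)"
    unfolding traj_def by (rule someI[of "solves rhs t y \<omega>"])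
  then show "continuous_on {t..b} (traj rhs t y \<omega>)"
    "t \<le> s \<Longrightarrow> traj rhs t y \<omega> s
      = (y + input \<omega> t s *\<^sub>R B) + integral {t..s} (\<lambda>r. A (traj rhs t y \<omega> r))"
    unfolding solves_rhs_iff[OF assms] by auto
qed

lemma traj_initial:
  assumes "\<omega> \<in> controls \<U>" "0 \<le> t"
  shows "traj rhs t y \<omega> t = y"
  using traj_eq[OF assms order_refl, of y] by (simp add: input_def)

lemma traj_tendsto:
  assumes \<omega>: "\<And>n. \<omega> n \<in> controls \<U>" "\<omega>' \<in> controls \<U>" and t: "0 \<le> t"
    and lim: "uniform_limit {t..b} (\<lambda>n. input (\<omega> n) t) (input \<omega>' t) sequentially"
    and s: "s \<in> {t..b}"
  shows "(\<lambda>n. traj rhs t y (\<omega> n) s) \<longlonglongrightarrow> traj rhs t y \<omega>' s"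
proof -
  obtain L where L: "0 \<le> L" "\<And>x. norm (A x) \<le> norm x * L"
    using bounded_linear.nonneg_bounded[OF A] by blast
  show ?thesis
  proof (rule tendstoI)
    fix e :: real assume e: "0 < e"
    \<comment> \<open>The stability estimate costs the factor \<open>norm B * exp (L * (s - t))\<close>; adding \<open>1\<close> covers \<open>B = 0\<close>.\<close>
    define d where "d = e / ((norm B + 1) * exp (L * (s - t)))"
    have d: "0 < d" using e by (simp add: d_def add_nonneg_pos)
    have "d * norm B * exp (L * (s - t)) < d * (norm B + 1) * exp (L * (s - t))"
      using d by simp
    also have "\<dots> = e"
      unfolding d_def using norm_ge_zero[of B] by (simp add: add_nonneg_eq_0_iff)
    finally have de: "d * norm B * exp (L * (s - t)) < e" .
    show "\<forall>\<^sub>F n in sequentially. dist (traj rhs t y (\<omega> n) s) (traj rhs t y \<omega>' s) < e"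
      using uniform_limitD[OF lim d]
    proof eventually_elim
      case (elim n)
      have "norm (traj rhs t y (\<omega> n) s - traj rhs t y \<omega>' s) \<le> d * norm B * exp (L * (s - t))"
      proof (rule volterra_stability[OF A L(2,1) _ _ _ _ _ s])
        fix r assume r: "r \<in> {t..b}"
        have "(y + input (\<omega> n) t r *\<^sub>R B) - (y + input \<omega>' t r *\<^sub>R B)
            = (input (\<omega> n) t r - input \<omega>' t r) *\<^sub>R B"
          by (simp add: scaleR_diff_left)
        moreover have "\<bar>input (\<omega> n) t r - input \<omega>' t r\<bar> * norm B \<le> d * norm B"
          using elim r by (intro mult_right_mono) (auto simp: dist_real_def less_imp_le)
        ultimately show "norm ((y + input (\<omega> n) t r *\<^sub>R B) - (y + input \<omega>' t r *\<^sub>R B)) \<le> d * norm B"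
          by simp
      qed (use traj_continuous traj_eq \<omega> t in auto)
      with de show ?case by (simp add: dist_norm)
    qed
  qed
qed

text \<open>
  Conversely, every curve with slopes between \<open>0\<close> and \<open>m\<close> is, up to its initial value, the
  cumulative input of a control: its density takes values in \<open>{0..m}\<close>, where \<open>\<sigma>\<close> inverts \<open>D\<close>.
\<close>

lemma control_of_input:
  assumes slope: "\<And>x y. x \<in> {t..b} \<Longrightarrow> y \<in> {t..b} \<Longrightarrow> x \<le> y \<Longrightarrow> 0 \<le> G y - G x \<and> G y - G x \<le> m * (y - x)"
    and "t \<le> b"
  obtains \<omega> where "\<omega> \<in> controls \<U>" "\<And>s. s \<in> {t..b} \<Longrightarrow> input \<omega> t s = G s - G t"
proof -
  \<comment> \<open>Clamping extends the curve to the whole line without increasing its slopes, so the resulting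
    control is defined at all times.\<close>
  define V where "V = (\<lambda>x. G (max t (min x b)))"
  have "0 \<le> V y - V x \<and> V y - V x \<le> m * (y - x)" if "x \<le> y" for x y
  proof -
    have "max t (min y b) - max t (min x b) \<le> y - x" using that by auto
    then have "m * (max t (min y b) - max t (min x b)) \<le> m * (y - x)"
      using m_nonneg by (rule mult_left_mono)
    moreover have "max t (min x b) \<le> max t (min y b)" using that by auto
    ultimately show ?thesis
      unfolding V_def using slope[of "max t (min x b)" "max t (min y b)"] \<open>t \<le> b\<close> by fastforce
  qed
  then obtain u where [measurable]: "u \<in> borel_measurable borel" and u: "\<And>x. 0 \<le> u x \<and> u x \<le> m"
    "\<And>x y. x \<le> y \<Longrightarrow> (u has_integral (V y - V x)) {x..y}"
    using bounded_slope_obtain_density[of V m] by blast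
  show thesis
  proof (rule that[of "\<lambda>s. \<sigma> (u s)"])
    have "(\<lambda>s. \<sigma> (u s)) \<in> borel_measurable lebesgue"
      by (intro measurable_completion) measurable
    then show "(\<lambda>s. \<sigma> (u s)) \<in> controls \<U>"
      using \<sigma> u(1) by (auto simp: controls_def intro: measurable_restrict_space1)
    fix s assume s: "s \<in> {t..b}"
    have "input (\<lambda>s. \<sigma> (u s)) t s = integral {t..s} u"
      unfolding input_def using \<sigma> u(1) by simp
    also have "\<dots> = V s - V t" using s by (intro integral_unique u(2)) auto
    finally show "input (\<lambda>s. \<sigma> (u s)) t s = G s - G t" using s by (simp add: V_def)
  qed
qed

text \<open>
  Cumulative inputs are uniformly bounded and share the Lipschitz constant \<open>m\<close>, so by
  Arzela--Ascoli a subsequence converges uniformly. The slope bounds survive in the limit, which is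
  therefore again a cumulative input, and stability carries the convergence over to trajectories.
\<close>

lemma traj_compact:
  assumes \<omega>: "\<And>n. \<omega> n \<in> controls \<U>" and t: "0 \<le> t" "t \<le> b"
  obtains \<omega>' k where "\<omega>' \<in> controls \<U>" "strict_mono (k :: nat \<Rightarrow> nat)"
    "\<And>s. s \<in> {t..b} \<Longrightarrow> (\<lambda>n. traj rhs t y (\<omega> (k n)) s) \<longlonglongrightarrow> traj rhs t y \<omega>' s"
proof -
  have slope: "0 \<le> input (\<omega> n) t y - input (\<omega> n) t x \<and> input (\<omega> n) t y - input (\<omega> n) t x \<le> m * (y - x)"
    if "x \<in> {t..b}" "x \<le> y" for n x y
    using input_slope[OF \<omega> t(1)] that by auto
  have input0: "input \<omega> t t = 0" for \<omega> by (simp add: input_def)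
  have norm_le: "norm (input (\<omega> n) t x - input (\<omega> n) t y) \<le> m * \<bar>x - y\<bar>"
    if "x \<in> {t..b}" "y \<in> {t..b}" for n x y
    using slope[of x y n] slope[of y x n] that by (cases "x \<le> y") (auto simp: abs_if)
  obtain G k where k: "strict_mono (k :: nat \<Rightarrow> nat)"
    and G: "\<And>e. 0 < e \<Longrightarrow> \<exists>N. \<forall>n x. n \<ge> N \<and> x \<in> {t..b} \<longrightarrow> norm (input (\<omega> (k n)) t x - G x) < e"
  proof (rule Arzela_Ascoli[of "{t..b}" "\<lambda>n. input (\<omega> n) t" "m * (b - t)"])
    show "norm (input (\<omega> n) t x) \<le> m * (b - t)" if "x \<in> {t..b}" for n x
      using slope[of t x n] that t mult_left_mono[of "x - t" "b - t" m] m_nonneg by (simp add: input0)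
    show "\<exists>d>0. \<forall>n y. y \<in> {t..b} \<and> norm (x - y) < d \<longrightarrow> norm (input (\<omega> n) t x - input (\<omega> n) t y) < e"
      if "x \<in> {t..b}" "0 < e" for x e
    proof (intro exI[of _ "e / (m + 1)"] conjI allI impI)
      show "0 < e / (m + 1)" using that m_nonneg by simp
      fix n y assume y: "y \<in> {t..b} \<and> norm (x - y) < e / (m + 1)"
      then have "norm (input (\<omega> n) t x - input (\<omega> n) t y) \<le> m * \<bar>x - y\<bar>"
        using norm_le that by blast
      also have "\<dots> \<le> (m + 1) * \<bar>x - y\<bar>" by (simp add: mult_right_mono)
      also have "\<dots> < e" using y m_nonneg by (simp add: pos_less_divide_eq mult.commute)
      finally show "norm (input (\<omega> n) t x - input (\<omega> n) t y) < e" .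
    qed
  qed auto
  have lim: "uniform_limit {t..b} (\<lambda>n. input (\<omega> (k n)) t) G sequentially"
    unfolding uniform_limit_sequentially_iff dist_norm using G by meson
  have ptw: "(\<lambda>n. input (\<omega> (k n)) t x) \<longlonglongrightarrow> G x" if "x \<in> {t..b}" for x
    by (rule tendsto_uniform_limitI[OF lim that])
  have "0 \<le> G y - G x \<and> G y - G x \<le> m * (y - x)" if xy: "x \<in> {t..b}" "y \<in> {t..b}" "x \<le> y" for x y
    using LIMSEQ_le_const[OF tendsto_diff[OF ptw ptw], of y x 0]
      LIMSEQ_le_const2[OF tendsto_diff[OF ptw ptw], of y x "m * (y - x)"] slope xy by blast
  then obtain \<omega>' where \<omega>': "\<omega>' \<in> controls \<U>" "\<And>s. s \<in> {t..b} \<Longrightarrow> input \<omega>' t s = G s - G t"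
    using control_of_input[OF _ t(2)] by metis
  have "G t = 0"
    using LIMSEQ_unique[OF ptw[of t], of 0] t by (simp add: input0)
  then have "uniform_limit {t..b} (\<lambda>n. input (\<omega> (k n)) t) (input \<omega>' t) sequentially"
    using lim \<omega>'(2) by (simp add: uniform_limit_sequentially_iff)
  from traj_tendsto[OF \<omega> \<omega>'(1) t(1) this] show thesis
    by (intro that[OF \<omega>'(1) k])
qed

text \<open>
  A viable control has nonpositive cost, hence so has the infimum. Conversely, controls with costs
  tending to at most \<open>0\<close> have trajectories whose distances to the target and to the constraint set
  tend to \<open>0\<close>; the limit trajectory provided by compactness lies in these closed sets.
  The inclusion of the target in the constraint set is what makes the two sides agree at
  the final time, where the value also involves the constraint at \<open>y\<close>.
\<close>

lemma Cap_eq_sublevel: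
  assumes C: "compact C" "C \<noteq> {}" and K: "closed K" and CK: "C \<subseteq> K" and t: "0 \<le> t" "t \<le> T"
  shows "Cap rhs \<U> K C T t =
    {y \<in> Omega. value_function rhs \<U> (signed_dist C) (signed_dist K) T t y \<le> 0}"
proof (cases "t = T")
  case True
  have "(\<exists>\<omega>\<in>controls \<U>. traj rhs T y \<omega> T \<in> C) \<longleftrightarrow> y \<in> C" for y
    using traj_initial controls_nonempty t True by auto
  moreover have "max (signed_dist C y) (signed_dist K y) \<le> 0 \<longleftrightarrow> y \<in> C" for y
    using signed_dist_le_0_iff[of C y] signed_dist_le_0_iff[OF K, of y] C CK compact_imp_closed by auto
  ultimately show ?thesis
    using True by (auto simp: Cap_def value_function_def)
next
  case False
  with t have tT: "t < T" by simp
  have K_ne: "K \<noteq> {}" using C CK by auto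
  have T_mem: "T \<in> {t..T}" and sub: "{t<..<T} \<subseteq> {t..T}" and ne: "{t<..<T} \<noteq> {}" using tT by auto
  define cost where "cost = (\<lambda>y \<omega>. max (signed_dist C (traj rhs t y \<omega> T))
      (SUP s\<in>{t<..<T}. signed_dist K (traj rhs t y \<omega> s)))"
  have value_eq: "value_function rhs \<U> (signed_dist C) (signed_dist K) T t y = (INF \<omega>\<in>controls \<U>. cost y \<omega>)" for y
    using False by (simp add: value_function_def cost_def)
  \<comment> \<open>Infima and suprema of reals are meaningful only for bounded sets: the costs are bounded below
    through the compact target, the running constraint is bounded above by continuity.\<close>
  obtain l where l: "\<And>x. l \<le> signed_dist C x" by (blast intro: signed_dist_bounded_below[OF C(1)])
  have bdd_cost: "bdd_below (cost y ` controls \<U>)" for y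
    by (rule bdd_belowI2[of _ l]) (use l in \<open>simp add: cost_def max.coboundedI1\<close>)
  have bdd_K: "bdd_above ((\<lambda>s. signed_dist K (traj rhs t y \<omega> s)) ` {t<..<T})"
    if \<omega>: "\<omega> \<in> controls \<U>" for y \<omega>
  proof -
    have "bdd_above ((\<lambda>s. infdist (traj rhs t y \<omega> s) K) ` {t..T})"
      by (intro bounded_imp_bdd_above compact_imp_bounded compact_continuous_image
          continuous_intros traj_continuous \<omega> t) simp
    then obtain h where "\<And>s. s \<in> {t..T} \<Longrightarrow> infdist (traj rhs t y \<omega> s) K \<le> h"
      unfolding bdd_above_def by blast
    with sub show ?thesis
      by (intro bdd_aboveI2[of _ _ h]) (blast intro: order_trans[OF signed_dist_le_infdist])
  qed
  show ?thesis
  proof (intro set_eqI iffI)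
    fix y assume "y \<in> Cap rhs \<U> K C T t"
    then obtain \<omega> where y: "y \<in> Omega" and \<omega>: "\<omega> \<in> controls \<U>" "traj rhs t y \<omega> T \<in> C"
        "\<And>s. s \<in> {t<..<T} \<Longrightarrow> traj rhs t y \<omega> s \<in> K"
      by (auto simp: Cap_def)
    have "(SUP s\<in>{t<..<T}. signed_dist K (traj rhs t y \<omega> s)) \<le> 0"
      using \<omega>(3) signed_dist_le_0_iff[OF K K_ne] by (intro cSUP_least ne) auto
    then have "cost y \<omega> \<le> 0"
      using \<omega>(2) signed_dist_le_0_iff[OF compact_imp_closed[OF C(1)] C(2)] by (simp add: cost_def)
    then have "(INF \<omega>\<in>controls \<U>. cost y \<omega>) \<le> 0"
      by (rule cINF_lower2[OF bdd_cost \<omega>(1)])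
    with y show "y \<in> {y \<in> Omega. value_function rhs \<U> (signed_dist C) (signed_dist K) T t y \<le> 0}"
      by (simp add: value_eq)
  next
    fix y assume "y \<in> {y \<in> Omega. value_function rhs \<U> (signed_dist C) (signed_dist K) T t y \<le> 0}"
    then have y: "y \<in> Omega" and le0: "(INF \<omega>\<in>controls \<U>. cost y \<omega>) \<le> 0" by (auto simp: value_eq)
    have "\<exists>\<omega>\<in>controls \<U>. cost y \<omega> < inverse (real (Suc n))" for n
      using le0 cINF_less_iff[OF controls_nonempty bdd_cost, of y "inverse (real (Suc n))"]
      by (smt (verit) inverse_positive_iff_positive of_nat_0_less_iff zero_less_Suc)
    then obtain \<omega> where \<omega>: "\<And>n. \<omega> n \<in> controls \<U>" "\<And>n. cost y (\<omega> n) < inverse (real (Suc n))"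
      by metis
    obtain \<omega>' k where \<omega>': "\<omega>' \<in> controls \<U>" and k: "strict_mono (k :: nat \<Rightarrow> nat)"
      and lim: "\<And>s. s \<in> {t..T} \<Longrightarrow> (\<lambda>n. traj rhs t y (\<omega> (k n)) s) \<longlonglongrightarrow> traj rhs t y \<omega>' s"
      using traj_compact[where \<omega> = \<omega>, OF \<omega>(1) t] by metis
    \<comment> \<open>Applied to the target at the final time and to the constraint set at the times before it.\<close>
    have limit_mem: "traj rhs t y \<omega>' s \<in> M"
      if M: "closed M" "M \<noteq> {}" and s: "s \<in> {t..T}"
        and small: "\<And>n. signed_dist M (traj rhs t y (\<omega> n) s) \<le> cost y (\<omega> n)" for M s
    proof -
      have "infdist (traj rhs t y (\<omega> n) s) M \<le> inverse (real (Suc n))" for n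
        using small[of n] \<omega>(2)[of n]
        by (intro less_imp_le infdist_less_of_signed_dist_less) (linarith, simp)
      then have "infdist (traj rhs t y (\<omega> (k n)) s) M \<le> inverse (real (Suc (k n)))" for n .
      moreover have "(\<lambda>n. inverse (real (Suc (k n)))) \<longlonglongrightarrow> 0"
        using LIMSEQ_subseq_LIMSEQ[OF LIMSEQ_inverse_real_of_nat k] by (simp add: o_def)
      moreover have "(\<lambda>n. infdist (traj rhs t y (\<omega> (k n)) s) M) \<longlonglongrightarrow> infdist (traj rhs t y \<omega>' s) M"
        by (rule tendsto_infdist[OF lim[OF s]])
      ultimately have "infdist (traj rhs t y \<omega>' s) M \<le> 0"
        by (intro LIMSEQ_le[of _ _ "\<lambda>n. inverse (real (Suc (k n)))"]) auto
      then show ?thesis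
        using in_closed_iff_infdist_zero[OF M] infdist_nonneg[of "traj rhs t y \<omega>' s" M] by simp
    qed
    have "traj rhs t y \<omega>' T \<in> C"
      by (rule limit_mem[OF compact_imp_closed[OF C(1)] C(2) T_mem]) (simp add: cost_def)
    moreover have "traj rhs t y \<omega>' s \<in> K" if s: "s \<in> {t<..<T}" for s
    proof (rule limit_mem[OF K K_ne])
      show "s \<in> {t..T}" using s by simp
      show "signed_dist K (traj rhs t y (\<omega> n) s) \<le> cost y (\<omega> n)" for n
        unfolding cost_def by (intro max.coboundedI2 cSUP_upper s bdd_K \<omega>(1))
    qed
    ultimately show "y \<in> Cap rhs \<U> K C T t" using y \<omega>' by (auto simp: Cap_def)
  qed
qed

end

section \<open>The capture basin of the inventory model\<close>

theorem theorem4p3: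
  fixes T a b c \<rho> \<alpha> \<beta> \<gamma> \<theta> q :: real
    and p_lo p_hi U_hi :: real
    and P_min P_max I_min I_max P_tgt I_tgt :: real
    and D :: "real \<times> real \<Rightarrow> real"
    and f :: "real \<times> real \<Rightarrow> real \<times> real \<Rightarrow> real \<times> real"
    and \<U> K C :: "(real \<times> real) set"
  assumes "T > 0"
    and "a > 0" "b > 0" "c > 0" "\<rho> > 0"
    and "\<beta> \<ge> 0" "\<gamma> \<ge> 0" "\<theta> \<ge> 0" "\<alpha> > \<gamma>" "q \<ge> 0"
    and "0 \<le> p_lo" "p_lo \<le> p_hi" "0 \<le> U_hi"
    and \<U>: "\<U> = {p_lo..p_hi} \<times> {0..U_hi}"
    and D: "D = demand \<rho> a b c q"
    and demand_nonneg: "\<forall>w\<in>\<U>. D w \<ge> 0"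
    and f: "f = dynamics \<alpha> \<beta> \<gamma> \<theta> D"
    and "0 \<le> P_min" "P_min \<le> P_max" "0 \<le> I_min" "I_min \<le> I_max"
    and K: "K = {P_min..P_max} \<times> {I_min..I_max}"
    and "P_tgt \<in> {P_min..P_max}" "I_tgt \<in> {I_min..I_max}"
    and C: "C = {P_tgt..P_max} \<times> {I_tgt..I_max}"
  shows "\<forall>t\<in>{0..T}.
    Cap f \<U> K C T t =
      {y \<in> Omega. value_function f \<U> (signed_dist C) (signed_dist K) T t y \<le> 0}"
proof
  fix t assume t: "t \<in> {0..T}"
  \<comment> \<open>Demand is largest at the lowest price and the largest second control component. Fixing that
    price and scaling the second component realizes every smaller value; when the largest demand is
    \<open>0\<close>, the quotient \<open>u / m\<close> is \<open>0\<close> by convention and the section still lands in the control set.\<close>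
  define m where "m = D (p_lo, U_hi)"
  define \<sigma> where "\<sigma> = (\<lambda>u. (p_lo, U_hi * (u / m)))"
  define A where "A = (\<lambda>x. (- \<beta> * snd x - \<gamma> * fst x, fst x - \<theta> * snd x))"
  define B where "B = (\<alpha>, - 1 :: real)"
  have m_nonneg: "0 \<le> m"
    using demand_nonneg assms by (simp add: m_def)
  interpret affine_control_system A B D m \<U> \<sigma>
  proof (rule affine_control_system.intro)
    show "bounded_linear A"
      unfolding A_def
      by (intro bounded_linear_Pair bounded_linear_sub bounded_linear_const_mult
          bounded_linear_fst bounded_linear_snd)
    show "D \<in> borel_measurable borel"
      unfolding D demand_def case_prod_beta
      by (intro borel_measurable_continuous_onI continuous_intros)
    show "\<sigma> \<in> borel_measurable borel"
      unfolding \<sigma>_def divide_inverse by (intro borel_measurable_continuous_onI continuous_intros)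
    show "0 \<le> m" by (rule m_nonneg)
    show "0 \<le> D w \<and> D w \<le> m" if w: "w \<in> \<U>" for w
    proof
      show "0 \<le> D w" using demand_nonneg w by blast
      obtain p U where w_eq: "w = (p, U)" and pU: "p_lo \<le> p" "0 \<le> U" "U \<le> U_hi"
        using w \<U> by auto
      have "\<rho> * U * (a - b * p + c * q) \<le> \<rho> * U * (a - b * p_lo + c * q)"
        using pU \<open>\<rho> > 0\<close> \<open>b > 0\<close> by (intro mult_left_mono) auto
      also have "\<dots> \<le> \<rho> * U_hi * (a - b * p_lo + c * q)"
      \<comment> \<open>The sign of the price factor is known only from the demand at a positive \<open>U_hi\<close>.\<close>
      proof (cases "U_hi = 0")
        case False
        then have "0 < \<rho> * U_hi" using \<open>\<rho> > 0\<close> \<open>0 \<le> U_hi\<close> by simp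
        moreover have "0 \<le> \<rho> * U_hi * (a - b * p_lo + c * q)"
          using m_nonneg by (simp add: m_def D demand_def)
        ultimately have "0 \<le> a - b * p_lo + c * q"
          by (simp add: zero_le_mult_iff)
        then show ?thesis
          using pU \<open>\<rho> > 0\<close> by (intro mult_right_mono mult_left_mono) auto
      qed (use pU in simp)
      finally show "D w \<le> m" by (simp add: w_eq m_def D demand_def)
    qed
    show "\<sigma> u \<in> \<U> \<and> D (\<sigma> u) = u" if u: "0 \<le> u" "u \<le> m" for u
    proof
      have "0 \<le> u / m" "u / m \<le> 1"
        using u m_nonneg by (auto simp: divide_le_eq_1)
      then have "0 \<le> U_hi * (u / m)" "U_hi * (u / m) \<le> U_hi"
        using \<open>0 \<le> U_hi\<close> by (simp_all add: mult_left_le del: times_divide_eq_right)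
      then show "\<sigma> u \<in> \<U>"
        using \<open>p_lo \<le> p_hi\<close> by (simp add: \<sigma>_def \<U>)
      have "D (\<sigma> u) = m * (u / m)"
        by (simp add: \<sigma>_def m_def D demand_def)
      then show "D (\<sigma> u) = u" using u by (cases "m = 0") auto
    qed
  qed
  have "f = rhs"
    unfolding fun_eq_iff rhs_def by (simp add: f dynamics_def A_def B_def algebra_simps)
  moreover have "compact C" "C \<noteq> {}" "closed K" "C \<subseteq> K"
    using assms by (auto simp: C K intro: compact_Times closed_Times)
  ultimately show "Cap f \<U> K C T t =
      {y \<in> Omega. value_function f \<U> (signed_dist C) (signed_dist K) T t y \<le> 0}"
    using Cap_eq_sublevel[of C K t T] t by simp
qed

end
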